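(* Let $a\geq1$ be an integer. The generalized sun graph $\mathcal{S}_6(a)=C_{6,1}(0,a,a,2a,a,a)$ is integral if and only if there exist integers $m\geq1$ and $k\geq1$ such that $$a=m(m+1)\qquad\text{and}\qquad 2m^2+2m+4=k^2.$$ In this case $\mathcal{S}_6(a)$ has $6m(m+1)+6$ vertices and $$\sigma\bigl(\mathcal{S}_6(a)\bigr)=\Bigl\{0^{[6a-4]},\ \pm m^{[2]},\ \pm(m+1)^{[2]},\ \pm k\Bigr\}.$$
   Context: A graph is integral if all eigenvalues of its adjacency matrix are integers; $\sigma(G)$ denotes the spectrum of the adjacency matrix, and $x^{[r]}$ means that the eigenvalue $x$ is listed with multiplicity $r$ (so $\pm x^{[r]}$ means that each of $x$ and $-x$ is listed with multiplicity $r$; no superscript means multiplicity $1$). For nonnegative integers $n_1,\dots,n_b$, $C_{b,1}(n_1,\dots,n_b)$ is the graph obtained from the cycle $C_b=v_1v_2\cdots v_bv_1$ by attaching $n_k$ pendant vertices to $v_k$ for $1\leq k\leq b$. *)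

theory Defs
  imports
    "Graph_Theory.Graph_Theory"
    "Jordan_Normal_Form.Char_Poly"
    "HOL-Computational_Algebra.Computational_Algebra"
begin

section \<open>Adjacency spectrum\<close>

definition adjacency_mat_wrt :: "'v list \<Rightarrow> 'v pair_pre_digraph \<Rightarrow> complex mat" where
  "adjacency_mat_wrt vs G =
     mat (length vs) (length vs) (\<lambda>(i, j). if (vs ! i, vs ! j) \<in> parcs G then 1 else 0)"

text \<open>
  The vertices are numbered in some arbitrary order. By \<open>char_poly_adjacency_mat\<close> and
  \<open>eigenvalue_adjacency_mat\<close> below, the choice affects neither the characteristic polynomial nor the
  eigenvalues. The entries are complex so that every root of the characteristic polynomial counts
  as an eigenvalue; that they are all real is not built in.
\<close>

definition adjacency_mat :: "'v pair_pre_digraph \<Rightarrow> complex mat" where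
  "adjacency_mat G = adjacency_mat_wrt (SOME vs. distinct vs \<and> set vs = pverts G) G"

text \<open>
  Eigenvalues are listed with their algebraic multiplicity, which agrees with the geometric one
  because the adjacency matrix of a graph is real symmetric.
\<close>

definition adjacency_spectrum :: "'v pair_pre_digraph \<Rightarrow> complex multiset" where
  "adjacency_spectrum G = proots (char_poly (adjacency_mat G))"

definition integral_graph :: "'v pair_pre_digraph \<Rightarrow> bool" where
  "integral_graph G \<longleftrightarrow> (\<forall>x. eigenvalue (adjacency_mat G) x \<longrightarrow> x \<in> \<int>)"

section \<open>Cycles with pendant vertices\<close>

text \<open>\<open>Cyc i\<close> is the cycle vertex $v_{i+1}$; \<open>Pend i j\<close> is the \<open>j\<close>-th pendant vertex at \<open>Cyc i\<close>.\<close>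

datatype vertex = Cyc nat | Pend nat nat

text \<open>
  The graph $C_{b,1}(n_1,\dots,n_b)$ for the list \<open>ns\<close> of the $n_k$, so that $b$ is \<open>length ns\<close>;
  the list is indexed from 0. As in \<^locale>\<open>pair_graph\<close>, an edge is a pair of opposite arcs.
  The construction is meant for $b \ge 3$.
\<close>

definition cycle_pendant_graph :: "nat list \<Rightarrow> vertex pair_pre_digraph" where
  "cycle_pendant_graph ns =
     (let b = length ns;
          E = {(Cyc i, Cyc (Suc i mod b)) | i. i < b}
            \<union> {(Cyc i, Pend i j) | i j. i < b \<and> j < ns ! i}
      in \<lparr> pverts = {Cyc i | i. i < b} \<union> {Pend i j | i j. i < b \<and> j < ns ! i},
           parcs = E \<union> E\<inverse> \<rparr>)"

definition sun_graph6 :: "nat \<Rightarrow> vertex pair_pre_digraph" where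
  "sun_graph6 a = cycle_pendant_graph [0, a, a, 2 * a, a, a]"

section \<open>Well-definedness\<close>

lemma similar_adjacency_mat_wrt:
  assumes vs: "distinct vs" and ws: "distinct ws" and eq: "set vs = set ws"
  shows "similar_mat (adjacency_mat_wrt vs G) (adjacency_mat_wrt ws G)"
proof -
  define n where "n = length vs"
  have lvs: "length vs = n" and lws: "length ws = n"
    using distinct_card[OF vs] distinct_card[OF ws] eq by (simp_all add: n_def)
  have "\<exists>j<n. ws ! j = vs ! i" if "i < n" for i
  proof -
    have "vs ! i \<in> set ws" using that lvs eq nth_mem[of i vs] by simp
    then show ?thesis by (simp add: in_set_conv_nth lws)
  qed
  then have "\<forall>i. \<exists>j. i < n \<longrightarrow> j < n \<and> ws ! j = vs ! i" by blast
  from choice[OF this] obtain f where "\<forall>i. i < n \<longrightarrow> f i < n \<and> ws ! f i = vs ! i" ..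
  then have f: "\<And>i. i < n \<Longrightarrow> f i < n" "\<And>i. i < n \<Longrightarrow> ws ! f i = vs ! i"
    by simp_all
  have inj: "f i = f j \<longleftrightarrow> i = j" if "i < n" "j < n" for i j
  proof
    assume "f i = f j"
    then have "vs ! i = vs ! j" using f(2)[OF that(1)] f(2)[OF that(2)] by metis
    then show "i = j" using nth_eq_iff_index_eq[OF vs] that lvs by blast
  qed (rule arg_cong)
  let ?A = "adjacency_mat_wrt vs G" and ?B = "adjacency_mat_wrt ws G"
  define P :: "complex mat" where "P = mat n n (\<lambda>(i, j). if j = f i then 1 else 0)"
  define Q :: "complex mat" where "Q = mat n n (\<lambda>(i, j). if i = f j then 1 else 0)"
  have car: "?A \<in> carrier_mat n n" "?B \<in> carrier_mat n n"
      "P \<in> carrier_mat n n" "Q \<in> carrier_mat n n"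
    by (auto simp: adjacency_mat_wrt_def P_def Q_def lvs lws)
  have P_mult: "(P * X) $$ (i, j) = X $$ (f i, j)"
    if "X \<in> carrier_mat n n" "i < n" "j < n" for X :: "complex mat" and i j
    using that f(1)[of i] by (simp add: P_def scalar_prod_def mult_delta_left)
  have mult_Q: "(X * Q) $$ (i, j) = X $$ (i, f j)"
    if "X \<in> carrier_mat n n" "i < n" "j < n" for X :: "complex mat" and i j
    using that f(1)[of j] by (simp add: Q_def scalar_prod_def mult_delta_right)
  have PQ: "P * Q = 1\<^sub>m n"
  proof (rule eq_matI)
    fix i j assume "i < dim_row (1\<^sub>m n :: complex mat)" "j < dim_col (1\<^sub>m n :: complex mat)"
    then have ij: "i < n" "j < n" by simp_all
    have "(P * Q) $$ (i, j) = Q $$ (f i, j)" by (rule P_mult[OF car(4) ij])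
    then show "(P * Q) $$ (i, j) = 1\<^sub>m n $$ (i, j)"
      using ij f(1) by (simp add: Q_def inj)
  qed (simp_all add: P_def Q_def)
  have QP: "Q * P = 1\<^sub>m n"
    by (rule mat_mult_left_right_inverse[OF car(3,4) PQ])
  have PB: "P * ?B \<in> carrier_mat n n" using car by simp
  have "?A = P * ?B * Q"
  proof (rule eq_matI)
    fix i j assume "i < dim_row (P * ?B * Q)" "j < dim_col (P * ?B * Q)"
    then have ij: "i < n" "j < n" using car by auto
    have "(P * ?B * Q) $$ (i, j) = ?B $$ (f i, f j)"
      using mult_Q[OF PB ij] P_mult[OF car(2) ij(1) f(1)[OF ij(2)]] by simp
    also have "\<dots> = ?A $$ (i, j)" using ij f by (simp add: adjacency_mat_wrt_def lvs lws)
    finally show "?A $$ (i, j) = (P * ?B * Q) $$ (i, j)" by simp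
  qed (use car in simp_all)
  then show ?thesis
    using car PQ QP by (intro similar_matI[of _ _ P Q n]) auto
qed

lemma some_vertex_list:
  assumes "finite V"
  defines "vs \<equiv> SOME vs. distinct vs \<and> set vs = V"
  shows "distinct vs" "set vs = V"
proof -
  have "\<exists>vs. distinct vs \<and> set vs = V"
    using finite_distinct_list[OF assms(1)] by blast
  from someI_ex[OF this] show "distinct vs" "set vs = V"
    unfolding vs_def by (rule conjunct1, rule conjunct2)
qed

lemma char_poly_adjacency_mat:
  assumes "distinct vs" and vs: "set vs = pverts G"
  shows "char_poly (adjacency_mat G) = char_poly (adjacency_mat_wrt vs G)"
proof -
  have fin: "finite (pverts G)" using vs[symmetric] by simp
  show ?thesis
    unfolding adjacency_mat_def
    by (rule char_poly_similar, rule similar_adjacency_mat_wrt)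
      (simp_all add: assms some_vertex_list[OF fin])
qed

lemma adjacency_mat_carrier:
  assumes "finite (pverts G)"
  shows "adjacency_mat G \<in> carrier_mat (card (pverts G)) (card (pverts G))"
  using distinct_card[OF some_vertex_list(1)[OF assms]]
  by (simp add: adjacency_mat_def adjacency_mat_wrt_def some_vertex_list[OF assms])

lemma eigenvalue_adjacency_mat:
  assumes "distinct vs" and "set vs = pverts G"
  shows "eigenvalue (adjacency_mat G) x \<longleftrightarrow> eigenvalue (adjacency_mat_wrt vs G) x"
proof -
  have fin: "finite (pverts G)" using assms(2)[symmetric] by simp
  have "adjacency_mat_wrt vs G \<in> carrier_mat (length vs) (length vs)"
    by (simp add: adjacency_mat_wrt_def)
  from eigenvalue_root_char_poly[OF this] show ?thesis
    unfolding eigenvalue_root_char_poly[OF adjacency_mat_carrier[OF fin]]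
      char_poly_adjacency_mat[OF assms] by simp
qed

lemma pair_graph_cycle_pendant_graph:
  assumes "length ns \<ge> 3"
  shows "pair_graph (cycle_pendant_graph ns)"
proof -
  let ?G = "cycle_pendant_graph ns" and ?b = "length ns"
  have "pverts ?G = Cyc ` {..<?b} \<union> (\<Union>i<?b. Pend i ` {..<ns ! i})"
    by (auto simp: cycle_pendant_graph_def Let_def)
  then have fin: "finite (pverts ?G)" by simp
  have "Suc i mod ?b < ?b" for i using assms by (intro mod_less_divisor) linarith
  then have wf: "parcs ?G \<subseteq> pverts ?G \<times> pverts ?G"
    by (auto simp: cycle_pendant_graph_def Let_def)
  have fin': "finite (parcs ?G)" by (rule finite_subset[OF wf]) (simp add: fin)
  have ne: "i \<noteq> Suc i mod ?b" if "i < ?b" for i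
  proof (cases "Suc i = ?b")
    case True
    then have "Suc i mod ?b = 0" by simp
    then show ?thesis using True assms by linarith
  next
    case False
    then have "Suc i mod ?b = Suc i" using that by (intro mod_less) linarith
    then show ?thesis by linarith
  qed
  have loopfree: "u \<noteq> v" if "(u, v) \<in> parcs ?G" for u v
  proof
    assume "u = v"
    with that obtain i where "i < ?b" "i = Suc i mod ?b"
      by (auto simp: cycle_pendant_graph_def Let_def)
    with ne show False by blast
  qed
  show ?thesis
  proof
    show "fst e \<noteq> snd e" if "e \<in> parcs ?G" for e
      using that loopfree[of "fst e" "snd e"] by simp
    show "symmetric (with_proj ?G)"
      unfolding symmetric_def with_proj_simps
      by (rule symI) (auto simp: cycle_pendant_graph_def Let_def)
    show "fst e \<in> pverts ?G" if "e \<in> parcs ?G" for e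
      using subsetD[OF wf that] by (rule mem_Times_iff[THEN iffD1, THEN conjunct1])
    show "snd e \<in> pverts ?G" if "e \<in> parcs ?G" for e
      using subsetD[OF wf that] by (rule mem_Times_iff[THEN iffD1, THEN conjunct2])
  qed (fact fin fin')+
qed

end

theory Submission
  imports Defs
begin

text \<open>
  Listing the cycle vertices first, the adjacency matrix is a block matrix with zero lower right
  block, and $B B^T$ is the diagonal matrix of the pendant numbers $n_k$. Eliminating the pendant
  vertices by a Schur complement turns the characteristic polynomial into
  $X^{n - b} \det (X^2 I - X C - \mathrm{diag}(n_k))$ with $n = \sum n_k$ and $C$ the adjacency
  matrix of the cycle. For $\mathcal{S}_6(a)$ the reflection symmetry makes this determinant factor,
  and the characteristic polynomial is
  $X^{6a-4} ((X^2 - X - a)(X^2 + X - a))^2 (X^2 - (2a + 4))$. Its roots are integers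
  iff $a = m(m + 1)$ and $2a + 4 = k^2$.
\<close>

lemma card_pverts_cycle_pendant_graph:
  "card (pverts (cycle_pendant_graph ns)) = length ns + sum_list ns"
proof -
  let ?P = "\<lambda>(i, j). Pend i j" and ?V = "SIGMA i:{..<length ns}. {..<ns ! i}"
  have "pverts (cycle_pendant_graph ns) = Cyc ` {..<length ns} \<union> ?P ` ?V"
    by (auto simp: cycle_pendant_graph_def Let_def image_iff)
  also have "card \<dots> = card (Cyc ` {..<length ns}) + card (?P ` ?V)"
    by (rule card_Un_disjoint) auto
  also have "\<dots> = card {..<length ns} + card ?V"
    by (subst (1 2) card_image) (auto simp: inj_on_def)
  also have "\<dots> = length ns + sum_list ns"
    by (simp add: sum_list_sum_nth atLeast0LessThan)
  finally show ?thesis .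
qed

section \<open>Determinant of a weighted hexagon\<close>

text \<open>Laplace expansion along the first row. Writing the minors again as
  \<open>mat_of_rows_list\<close> lets the rule be iterated by rewriting down to the empty
  matrix.\<close>

lemma det_mat_of_rows_list_Cons:
  fixes r :: "'a :: comm_ring_1 list"
  assumes "length rs = n" and "\<forall>s\<in>set rs. length s = Suc n"
  shows "det (mat_of_rows_list (Suc n) (r # rs)) =
    (\<Sum>j<Suc n. r ! j * ((-1) ^ j * det (mat_of_rows_list n (map (\<lambda>s. take j s @ drop (Suc j) s) rs))))"
proof -
  have "mat_delete (mat_of_rows_list (Suc n) (r # rs)) 0 j =
      mat_of_rows_list n (map (\<lambda>s. take j s @ drop (Suc j) s) rs)" if "j < Suc n" for j
    using assms that
    by (intro eq_matI) (auto simp: mat_delete_def mat_of_rows_list_def nth_append min_def)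
  with assms(1) show ?thesis
    by (subst laplace_expansion_row[of _ "Suc n" 0])
      (auto simp: cofactor_def mat_of_rows_list_def intro!: sum.cong)
qed

text \<open>As a congruence rule, this keeps the simplifier from expanding minors whose coefficient vanishes.\<close>

lemma mult_zero_cong:
  fixes a b :: "'a :: mult_zero"
  shows "a = a' \<Longrightarrow> (a' \<noteq> 0 \<Longrightarrow> b = b') \<Longrightarrow> a * b = a' * b'"
  by (cases "a' = 0") auto

text \<open>The two factors reflect the symmetry that fixes positions 0 and 3 and swaps 1 with 5 and
  2 with 4. Antisymmetric vectors give the 2 x 2 block with determinant
  \<open>d1 * d2 - x\<^sup>2\<close>; symmetric ones give a tridiagonal 4 x 4 block, whose
  continuant is the other factor. The proof itself just expands both sides.\<close>

lemma det_hexagon: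
  fixes x :: "'a :: comm_ring_1"
  shows "det (mat_of_rows_list 6
     [[d0, x, 0, 0, 0, x],
      [x, d1, x, 0, 0, 0],
      [0, x, d2, x, 0, 0],
      [0, 0, x, d3, x, 0],
      [0, 0, 0, x, d2, x],
      [x, 0, 0, 0, x, d1]]) =
    (d1 * d2 - x\<^sup>2) * (d0 * (d1 * (d2 * d3 - 2 * x\<^sup>2) - x\<^sup>2 * d3) - 2 * x\<^sup>2 * (d2 * d3 - 2 * x\<^sup>2))"
proof -
  have [simp]: "det (mat_of_rows_list 0 []) = (1 :: 'a)"
    by (rule det_dim_zero) (simp add: mat_of_rows_list_def)
  show ?thesis
    apply (simp add: eval_nat_numeral)
    \<comment> \<open>Each round expands the determinants with explicit rows; \<open>simp\<close>
      then makes the rows of the surviving minors explicit for the next round.\<close>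
    apply (((subst det_mat_of_rows_list_Cons, simp, simp)+, simp cong: mult_zero_cong)+)[1]
    apply (simp only: ring_distribs mult.assoc mult_minus_left mult_minus_right minus_minus)
    apply (simp add: algebra_simps)
    done
qed

section \<open>Elimination of the pendant vertices\<close>

text \<open>The Schur complement of the block X I is X I - A - X^(-1) B C. Scaling its n rows by X
  keeps everything polynomial and accounts for the factor X^n on the left.\<close>

lemma x_power_mult_char_poly_four_block_mat:
  fixes A :: "'a :: idom mat"
  assumes A: "A \<in> carrier_mat n n" and B: "B \<in> carrier_mat n m" and C: "C \<in> carrier_mat m n"
  shows "[:0, 1:] ^ n * char_poly (four_block_mat A B C (0\<^sub>m m m)) =
    [:0, 1:] ^ m * det ([:0, 1:] \<cdot>\<^sub>m char_poly_matrix A - map_mat (\<lambda>c. [:c:]) (B * C))"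
proof -
  let ?x = "[:0, 1 :: 'a:]" and ?h = "map_mat (\<lambda>c :: 'a. [:c:])"
  let ?S = "?x \<cdot>\<^sub>m char_poly_matrix A - ?h (B * C)"
  let ?M = "char_poly_matrix (four_block_mat A B C (0\<^sub>m m m))"
  \<comment> \<open>Right multiplication by \<open>?N\<close> scales the first block column by X and
    adds the second one times C. This cancels the lower left block, since - C X + X C = 0.\<close>
  let ?N = "four_block_mat (?x \<cdot>\<^sub>m 1\<^sub>m n) (0\<^sub>m n m) (?h C) (1\<^sub>m m)"
  have hom: "?h (B * C) = ?h B * ?h C"
    using B C by (intro eq_matI) (auto simp: scalar_prod_def sum_to_poly mult_ac)
  have M: "?M = four_block_mat (char_poly_matrix A) (- ?h B) (- ?h C) (?x \<cdot>\<^sub>m 1\<^sub>m m)"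
    using A B C by (intro eq_matI) (auto simp: char_poly_matrix_def)
  have carrier: "char_poly_matrix A \<in> carrier_mat n n" "?h B \<in> carrier_mat n m"
      "?h C \<in> carrier_mat m n"
    using A B C by auto
  have "?M * ?N = four_block_mat
      (char_poly_matrix A * (?x \<cdot>\<^sub>m 1\<^sub>m n) + - ?h B * ?h C)
      (char_poly_matrix A * 0\<^sub>m n m + - ?h B * 1\<^sub>m m)
      (- ?h C * (?x \<cdot>\<^sub>m 1\<^sub>m n) + (?x \<cdot>\<^sub>m 1\<^sub>m m) * ?h C)
      (- ?h C * 0\<^sub>m n m + (?x \<cdot>\<^sub>m 1\<^sub>m m) * 1\<^sub>m m)"
    unfolding M by (rule mult_four_block_mat) (use carrier in auto)
  also have "char_poly_matrix A * (?x \<cdot>\<^sub>m 1\<^sub>m n) + - ?h B * ?h C = ?S"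
    using carrier mult_smult_distrib[OF carrier(1) one_carrier_mat]
    by (simp add: hom minus_add_uminus_mat[of _ n n])
  also have "char_poly_matrix A * 0\<^sub>m n m + - ?h B * 1\<^sub>m m = - ?h B"
    using carrier by simp
  also have "- ?h C * (?x \<cdot>\<^sub>m 1\<^sub>m n) + (?x \<cdot>\<^sub>m 1\<^sub>m m) * ?h C = 0\<^sub>m m n"
    using carrier mult_smult_distrib[OF uminus_carrier_mat[OF carrier(3)] one_carrier_mat]
      mult_smult_assoc_mat[OF one_carrier_mat carrier(3)]
    by (intro eq_matI) auto
  also have "- ?h C * 0\<^sub>m n m + (?x \<cdot>\<^sub>m 1\<^sub>m m) * 1\<^sub>m m = ?x \<cdot>\<^sub>m 1\<^sub>m m"
    using carrier by simp
  finally have "?M * ?N = four_block_mat ?S (- ?h B) (0\<^sub>m m n) (?x \<cdot>\<^sub>m 1\<^sub>m m)" .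
  moreover have "det ?N = ?x ^ n"
    using carrier by (subst det_four_block_mat_upper_right_zero[of _ n _ m]) auto
  moreover have "det (four_block_mat ?S (- ?h B) (0\<^sub>m m n) (?x \<cdot>\<^sub>m 1\<^sub>m m)) = det ?S * ?x ^ m"
    using A B C by (subst det_four_block_mat_lower_left_zero[of _ n _ m]) auto
  moreover have "det (?M * ?N) = det ?M * det ?N"
    using A C by (intro det_mult[of _ "n + m"]) auto
  ultimately show ?thesis
    by (simp add: char_poly_def mult_ac)
qed

text \<open>Powers of X stand on both sides because \<open>sum_list ns\<close> may be smaller than
  \<open>b\<close>, so that dividing by X^b need not leave a power of X in front of the
  determinant.\<close>

lemma x_power_mult_char_poly_cycle_pendant_graph:
  fixes ns :: "nat list"
  defines "b \<equiv> length ns"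
  shows "[:0, 1:] ^ b * char_poly (adjacency_mat (cycle_pendant_graph ns)) =
    [:0, 1:] ^ sum_list ns * det (mat b b (\<lambda>(i, j). (if i = j then [:- of_nat (ns ! i), 0, 1:] else 0)
      - (if j = Suc i mod b \<or> i = Suc j mod b then [:0, 1:] else 0)))"
proof -
  let ?G = "cycle_pendant_graph ns"
  define V where "V = (SIGMA i:{..<b}. {..<ns ! i})"
  have "finite V" by (simp add: V_def)
  then obtain ps where ps: "distinct ps" "set ps = V" using finite_distinct_list by blast
  have len: "length ps = sum_list ns"
    using distinct_card[OF ps(1)] by (simp add: ps(2) V_def b_def sum_list_sum_nth atLeast0LessThan)
  define vs where "vs = map Cyc [0..<b] @ map (\<lambda>(i, j). Pend i j) ps"
  have "distinct vs"
    using ps(1) by (auto simp: vs_def distinct_map inj_on_def)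
  moreover have "set vs = pverts ?G"
    by (auto simp: vs_def ps(2) V_def cycle_pendant_graph_def Let_def b_def image_iff)
  ultimately have char_poly: "char_poly (adjacency_mat ?G) = char_poly (adjacency_mat_wrt vs ?G)"
    by (rule char_poly_adjacency_mat)
  define A :: "complex mat"
    where "A = mat b b (\<lambda>(i, j). if j = Suc i mod b \<or> i = Suc j mod b then 1 else 0)"
  define B :: "complex mat"
    where "B = mat b (length ps) (\<lambda>(i, p). if fst (ps ! p) = i then 1 else 0)"
  have ps_nth: "fst (ps ! p) < b \<and> snd (ps ! p) < ns ! fst (ps ! p)" if "p < length ps" for p
    using nth_mem[OF that] by (auto simp: ps(2) V_def)
  have arcs:
      "(Cyc i, Cyc j) \<in> parcs ?G \<longleftrightarrow> i < b \<and> j = Suc i mod b \<or> j < b \<and> i = Suc j mod b"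
      "(Cyc i, Pend j l) \<in> parcs ?G \<longleftrightarrow> i < b \<and> j = i \<and> l < ns ! i"
      "(Pend j l, Cyc i) \<in> parcs ?G \<longleftrightarrow> i < b \<and> j = i \<and> l < ns ! i"
      "(Pend j l, Pend j' l') \<notin> parcs ?G" for i j l j' l'
    by (auto simp: cycle_pendant_graph_def Let_def b_def)
  have "adjacency_mat_wrt vs ?G = four_block_mat A B (transpose_mat B) (0\<^sub>m (length ps) (length ps))"
  proof (rule eq_matI, goal_cases)
    case (1 i j)
    then have "i < b + length ps" "j < b + length ps" by (simp_all add: A_def)
    then show ?case
      using ps_nth[of "i - b"] ps_nth[of "j - b"]
      by (cases "i < b"; cases "j < b")
        (simp_all add: adjacency_mat_wrt_def vs_def nth_append A_def B_def arcs case_prod_beta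
          eq_commute[of "fst _"])
  qed (simp_all add: adjacency_mat_wrt_def vs_def A_def)
  \<comment> \<open>Every pendant vertex has exactly one neighbour, so distinct rows of
    \<open>B\<close> have disjoint supports, and row i contains \<open>ns ! i\<close> ones.\<close>
  moreover have "B * transpose_mat B = mat b b (\<lambda>(i, j). if i = j then of_nat (ns ! i) else 0)"
  proof (rule eq_matI, goal_cases)
    case (1 i j)
    then have ij: "i < b" "j < b" by simp_all
    have "(B * transpose_mat B) $$ (i, j) =
        (\<Sum>p<length ps. if fst (ps ! p) = i \<and> fst (ps ! p) = j then 1 else 0)"
      using ij by (auto simp: B_def scalar_prod_def atLeast0LessThan intro!: sum.cong)
    also have "\<dots> = (\<Sum>v\<in>V. if fst v = i \<and> fst v = j then 1 else 0)"
      using sum.reindex_bij_betw[OF bij_betw_nth[OF ps(1) refl refl],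
          of "\<lambda>v. if fst v = i \<and> fst v = j then 1 else 0 :: complex"]
      by (simp add: ps(2))
    also have "\<dots> = (\<Sum>k<b. \<Sum>l<ns ! k. if k = i \<and> k = j then 1 else 0)"
      unfolding V_def by (subst sum.Sigma) (auto intro!: sum.cong)
    also have "\<dots> = (\<Sum>k<b. if k = i then (if i = j then of_nat (ns ! i) else 0) else 0)"
      by (rule sum.cong) auto
    finally show ?case
      using ij by simp
  qed (simp_all add: B_def)
  ultimately have "[:0, 1:] ^ b * char_poly (adjacency_mat ?G) = [:0, 1:] ^ length ps *
      det ([:0, 1:] \<cdot>\<^sub>m char_poly_matrix A
        - map_mat (\<lambda>c. [:c:]) (mat b b (\<lambda>(i, j). if i = j then of_nat (ns ! i) else 0)))"
    using x_power_mult_char_poly_four_block_mat[of A b B "length ps" "transpose_mat B"]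
    by (simp add: char_poly A_def B_def)
  also have "[:0, 1:] \<cdot>\<^sub>m char_poly_matrix A
        - map_mat (\<lambda>c. [:c:]) (mat b b (\<lambda>(i, j). if i = j then of_nat (ns ! i) else 0)) =
      mat b b (\<lambda>(i, j). (if i = j then [:- of_nat (ns ! i), 0, 1:] else 0)
        - (if j = Suc i mod b \<or> i = Suc j mod b then [:0, 1:] else 0))"
    by (rule eq_matI) (auto simp: A_def char_poly_matrix_def)
  finally show ?thesis
    by (simp add: len)
qed

section \<open>Characteristic polynomial of the sun graph\<close>

lemma char_poly_sun_graph6:
  assumes "a \<ge> 1"
  shows "char_poly (adjacency_mat (sun_graph6 a)) = [:0, 1:] ^ (6 * a - 4) *
    ([:- of_nat a, -1, 1:] * [:- of_nat a, 1, 1:])\<^sup>2 * [:- of_nat (2 * a + 4), 0, 1:]"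
proof -
  let ?x = "[:0, 1 :: complex:]"
  let ?d = "\<lambda>n :: nat. [:- of_nat n, 0, 1 :: complex:]"
  have mat: "mat 6 6 (\<lambda>(i, j). (if i = j then ?d ([0, a, a, 2 * a, a, a] ! i) else 0)
        - (if j = Suc i mod 6 \<or> i = Suc j mod 6 then ?x else 0)) =
      mat_of_rows_list 6
       [[?d 0, - ?x, 0, 0, 0, - ?x],
        [- ?x, ?d a, - ?x, 0, 0, 0],
        [0, - ?x, ?d a, - ?x, 0, 0],
        [0, 0, - ?x, ?d (2 * a), - ?x, 0],
        [0, 0, 0, - ?x, ?d a, - ?x],
        [- ?x, 0, 0, 0, - ?x, ?d a]]"
  proof (rule eq_matI, goal_cases)
    case (1 i j)
    then have "i < 6" "j < 6" by (simp_all add: mat_of_rows_list_def)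
    then have "i = 0 \<or> i = 1 \<or> i = 2 \<or> i = 3 \<or> i = 4 \<or> i = 5"
        "j = 0 \<or> j = 1 \<or> j = 2 \<or> j = 3 \<or> j = 4 \<or> j = 5"
      by linarith+
    then show ?case
      by (elim disjE) (simp_all add: mat_of_rows_list_def)
  qed (simp_all add: mat_of_rows_list_def)
  \<comment> \<open>Expressing all polynomials through \<open>?x\<close> reduces the factorization
    to a ring identity in an abstract X.\<close>
  have d: "?d n = ?x\<^sup>2 - of_nat n" for n
    by (simp add: power2_eq_square of_nat_poly)
  have quadratics: "[:- of_nat a, -1, 1:] = ?x\<^sup>2 - ?x - of_nat a" "[:- of_nat a, 1, 1:] = ?x\<^sup>2 + ?x - of_nat a"
    by (simp_all add: power2_eq_square of_nat_poly)
  \<comment> \<open>Put D = X^2 - a and E = X^2 - 2a. The antisymmetric factor D^2 - X^2 reappears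
    in the symmetric one because X^2 + E = 2D, which turns the latter into X^2 (D^2 - X^2) (E - 4).
    This is the effect of placing 2a pendant vertices opposite the bare vertex.\<close>
  have identity: "((X\<^sup>2 - of_nat a) * (X\<^sup>2 - of_nat a) - X\<^sup>2) *
      ((X\<^sup>2 - of_nat 0) * ((X\<^sup>2 - of_nat a) * ((X\<^sup>2 - of_nat a) * (X\<^sup>2 - of_nat (2 * a)) - 2 * X\<^sup>2)
          - X\<^sup>2 * (X\<^sup>2 - of_nat (2 * a)))
        - 2 * X\<^sup>2 * ((X\<^sup>2 - of_nat a) * (X\<^sup>2 - of_nat (2 * a)) - 2 * X\<^sup>2)) =
      X\<^sup>2 * (((X\<^sup>2 - X - of_nat a) * (X\<^sup>2 + X - of_nat a))\<^sup>2 * (X\<^sup>2 - of_nat (2 * a + 4)))"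
    for X :: "complex poly"
    by (simp add: algebra_simps power2_eq_square)
  have "?x ^ 6 * char_poly (adjacency_mat (sun_graph6 a)) =
      ?x ^ (6 * a) * ((?d a * ?d a - ?x\<^sup>2) * (?d 0 * (?d a * (?d a * ?d (2 * a) - 2 * ?x\<^sup>2) - ?x\<^sup>2 * ?d (2 * a))
        - 2 * ?x\<^sup>2 * (?d a * ?d (2 * a) - 2 * ?x\<^sup>2)))"
  proof -
    have "length [0, a, a, 2 * a, a, a] = 6" "sum_list [0, a, a, 2 * a, a, a] = 6 * a" by simp_all
    note x_power_mult_char_poly_cycle_pendant_graph[of "[0, a, a, 2 * a, a, a]", unfolded this]
    then show ?thesis by (simp only: sun_graph6_def mat det_hexagon power2_minus)
  qed
  also have "\<dots> = ?x ^ (6 * a) * (?x\<^sup>2 *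
      (([:- of_nat a, -1, 1:] * [:- of_nat a, 1, 1:])\<^sup>2 * [:- of_nat (2 * a + 4), 0, 1:]))"
    unfolding d quadratics by (simp only: identity)
  also have "\<dots> = ?x ^ 6 * (?x ^ (6 * a - 4) *
      ([:- of_nat a, -1, 1:] * [:- of_nat a, 1, 1:])\<^sup>2 * [:- of_nat (2 * a + 4), 0, 1:])"
  proof -
    \<comment> \<open>The truncated subtraction is exact because \<open>a\<close> is
      positive.\<close>
    have "6 * a + 2 = 6 + (6 * a - 4)" using assms by simp
    then have "?x ^ (6 * a) * ?x\<^sup>2 = ?x ^ 6 * ?x ^ (6 * a - 4)" by (metis power_add)
    then show ?thesis by (simp only: mult.assoc[symmetric])
  qed
  finally show ?thesis
    by simp
qed

lemma poly_char_poly_sun_graph6_eq_0_iff: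
  assumes "a \<ge> 1"
  shows "poly (char_poly (adjacency_mat (sun_graph6 a))) z = 0 \<longleftrightarrow>
    z = 0 \<or> z\<^sup>2 - z = of_nat a \<or> z\<^sup>2 + z = of_nat a \<or> z\<^sup>2 = of_nat (2 * a + 4)"
proof -
  have "poly [:- c, b, 1:] z = z\<^sup>2 + b * z - c" for b c
    by (simp add: power2_eq_square algebra_simps)
  then have quadratic: "poly [:- c, b, 1:] z = 0 \<longleftrightarrow> z\<^sup>2 + b * z = c" for b c
    by simp
  \<comment> \<open>A positive exponent is what makes 0 a root.\<close>
  have "6 * a - 4 > 0" using assms by simp
  then have "poly ([:0, 1:] ^ (6 * a - 4)) z = 0 \<longleftrightarrow> z = 0" by simp
  then show ?thesis
    unfolding char_poly_sun_graph6[OF assms] poly_mult poly_power[of "_ * _"] mult_eq_0_iff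
      power_eq_0_iff quadratic
    by auto
qed

text \<open>For a = m(m + 1) the quadratics X^2 - X - a and X^2 + X - a have the roots m + 1, -m and
  m, -(m + 1), while 2a + 4 = k^2 splits the last factor.\<close>

lemma char_poly_sun_graph6_factored:
  assumes "m \<ge> 1" and "a = m * (m + 1)" and "2 * m\<^sup>2 + 2 * m + 4 = k\<^sup>2"
  shows "char_poly (adjacency_mat (sun_graph6 a)) = [:0, 1:] ^ (6 * a - 4) *
    ([:- of_nat m, 1:]\<^sup>2 * [:of_nat m, 1:]\<^sup>2 * [:- of_nat (m + 1), 1:]\<^sup>2 * [:of_nat (m + 1), 1:]\<^sup>2 *
      ([:- of_nat k, 1:] * [:of_nat k, 1:]))"
proof -
  have "2 * a + 4 = k * k"
    using assms(2,3) by (simp add: power2_eq_square algebra_simps)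
  then have k: "[:- of_nat (2 * a + 4), 0, 1:] = [:- of_nat k, 1:] * [:of_nat k, 1 :: complex:]"
    by (simp only: of_nat_mult) simp
  have m: "[:- of_nat a, -1, 1:] = [:- of_nat (m + 1), 1:] * [:of_nat m, 1 :: complex:]"
      "[:- of_nat a, 1, 1:] = [:of_nat (m + 1), 1:] * [:- of_nat m, 1 :: complex:]"
    by (simp_all add: assms(2) algebra_simps)
  have "a \<ge> 1" using assms(1,2) by simp
  then show ?thesis
    by (simp only: char_poly_sun_graph6 k m power_mult_distrib) (simp only: mult_ac)
qed

lemma card_pverts_sun_graph6: "card (pverts (sun_graph6 a)) = 6 * a + 6"
  by (simp add: sun_graph6_def card_pverts_cycle_pendant_graph)

section \<open>Integrality criterion and spectrum\<close>

theorem theorem3p4: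
  fixes a :: nat
  assumes "a \<ge> 1"
  shows "(integral_graph (sun_graph6 a) \<longleftrightarrow>
            (\<exists>m k :: nat. m \<ge> 1 \<and> k \<ge> 1 \<and> a = m * (m + 1) \<and> 2 * m\<^sup>2 + 2 * m + 4 = k\<^sup>2))
       \<and> (\<forall>m k :: nat. m \<ge> 1 \<and> k \<ge> 1 \<and> a = m * (m + 1) \<and> 2 * m\<^sup>2 + 2 * m + 4 = k\<^sup>2 \<longrightarrow>
            card (pverts (sun_graph6 a)) = 6 * m * (m + 1) + 6
          \<and> adjacency_spectrum (sun_graph6 a) =
              replicate_mset (6 * a - 4) 0
            + replicate_mset 2 (of_nat m) + replicate_mset 2 (- of_nat m)
            + replicate_mset 2 (of_nat (m + 1)) + replicate_mset 2 (- of_nat (m + 1))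
            + {# of_nat k, - of_nat k #})"
proof (intro conjI allI impI iffI; (elim exE conjE)?)
  let ?G = "sun_graph6 a"
  have "finite (pverts ?G)" by (rule card_ge_0_finite) (simp add: card_pverts_sun_graph6)
  then have eigenvalue: "eigenvalue (adjacency_mat ?G) z \<longleftrightarrow>
      poly (char_poly (adjacency_mat ?G)) z = 0" for z
    by (rule eigenvalue_root_char_poly[OF adjacency_mat_carrier])
  {
    assume "integral_graph ?G"
    then have integral: "poly (char_poly (adjacency_mat ?G)) z = 0 \<Longrightarrow> z \<in> \<int>" for z
      by (simp add: integral_graph_def eigenvalue)
    \<comment> \<open>A root of X^2 - X - a from the quadratic formula; by integrality it must be an
      integer \<open>r\<close>.\<close>
    define z :: complex where "z = (1 + csqrt (1 + 4 * of_nat a)) / 2"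
    have z: "z\<^sup>2 - z = of_nat a"
    proof -
      have "(csqrt (1 + 4 * of_nat a))\<^sup>2 = 1 + 4 * of_nat a" by (rule power2_csqrt)
      then show ?thesis by (simp add: z_def power2_eq_square field_simps)
    qed
    then obtain r :: int where r: "z = of_int r"
      using integral assms by (auto simp: poly_char_poly_sun_graph6_eq_0_iff elim: Ints_cases)
    have "of_int (r\<^sup>2 - r) = (of_int (int a) :: complex)" using z by (simp add: r)
    then have "r * (r - 1) = int a"
      by (simp only: of_int_eq_iff power2_eq_square) (simp add: algebra_simps)
    \<comment> \<open>The roots of X^2 - X - a are to be m + 1 and -m. Covering both cases avoids
      determining the sign of \<open>r\<close>.\<close>
    define m where "m = nat (if r > 0 then r - 1 else - r)"
    have "int m = (if r > 0 then r - 1 else - r)" by (simp add: m_def)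
    then have "int (m * (m + 1)) = int a"
      using \<open>r * (r - 1) = int a\<close> by (auto simp: algebra_simps split: if_splits)
    then have m: "a = m * (m + 1)" by (simp only: of_nat_eq_iff)
    \<comment> \<open>The square root of 2a + 4 is an eigenvalue too, hence an integer
      \<open>s\<close>; its absolute value serves as k.\<close>
    have "(csqrt (of_nat (2 * a + 4)))\<^sup>2 = of_nat (2 * a + 4)" by (rule power2_csqrt)
    then have "csqrt (of_nat (2 * a + 4)) \<in> \<int>"
      by (intro integral) (simp only: poly_char_poly_sun_graph6_eq_0_iff[OF assms] simp_thms)
    then obtain s :: int where "csqrt (of_nat (2 * a + 4)) = of_int s" by (rule Ints_cases)
    with power2_csqrt[of "of_nat (2 * a + 4)"]
    have "of_int (s\<^sup>2) = (of_int (int (2 * a + 4)) :: complex)" by simp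
    then have "s\<^sup>2 = int (2 * a + 4)" by (simp only: of_int_eq_iff)
    then have "int ((nat \<bar>s\<bar>)\<^sup>2) = int (2 * a + 4)" by simp
    then have k: "2 * a + 4 = (nat \<bar>s\<bar>)\<^sup>2" by (simp only: of_nat_eq_iff)
    have "m \<ge> 1" using m assms by (cases m) auto
    moreover have "nat \<bar>s\<bar> \<ge> 1" using k by (cases "nat \<bar>s\<bar>") auto
    moreover have "2 * m\<^sup>2 + 2 * m + 4 = (nat \<bar>s\<bar>)\<^sup>2"
      unfolding k[symmetric] by (simp add: m power2_eq_square algebra_simps)
    ultimately show "\<exists>m k :: nat. m \<ge> 1 \<and> k \<ge> 1 \<and> a = m * (m + 1) \<and> 2 * m\<^sup>2 + 2 * m + 4 = k\<^sup>2"
      using m by blast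
  }
  \<comment> \<open>The three remaining goals share these assumptions and all follow from a = m(m +
    1) or the factorization into linear factors.\<close>
  fix m k :: nat
  assume mk: "m \<ge> 1" "a = m * (m + 1)" "2 * m\<^sup>2 + 2 * m + 4 = k\<^sup>2"
  note char_poly = char_poly_sun_graph6_factored[OF mk]
  have linear: "poly [:c, 1:] z = 0 \<longleftrightarrow> z = - c" for c z :: complex
    by (simp add: add_eq_0_iff)
  show "integral_graph ?G"
    unfolding integral_graph_def eigenvalue char_poly poly_mult poly_power mult_eq_0_iff
      power_eq_0_iff linear
    by (auto simp del: of_nat_add of_nat_Suc)
  show "card (pverts ?G) = 6 * m * (m + 1) + 6"
    by (simp add: card_pverts_sun_graph6 mk(2))
  show "adjacency_spectrum ?G = replicate_mset (6 * a - 4) 0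
      + replicate_mset 2 (of_nat m) + replicate_mset 2 (- of_nat m)
      + replicate_mset 2 (of_nat (m + 1)) + replicate_mset 2 (- of_nat (m + 1))
      + {# of_nat k, - of_nat k #}"
    \<comment> \<open>\<open>proots\<close> turns products into multiset sums, so coincidences among
      the listed values need no check. The deleted simp rules would multiply the linear factors
      out.\<close>
    unfolding adjacency_spectrum_def char_poly
    by (simp add: proots_mult proots_power add_ac
        del: of_nat_add of_nat_Suc mult_pCons_left mult_pCons_right)
qed

end
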